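(* Let $n\ge2$ be an integer, $p\in(0,1)$, and let $M=M^{(p,n)}$ be the limit set of Mandelbrot's fractal percolation process with parameters $p,n$. If $p>\frac{1}{\sqrt n}$ then almost surely $$\dim_{tH}M\le 2+2\,\frac{\log p}{\log n}.$$
   Context: Fractal percolation: let $p\in(0,1)$ and $n\ge2$ an integer. Set $M_0=[0,1]^2$. Divide the unit square into $n^2$ equal closed sub-squares of side-length $1/n$ in the natural way; keep each sub-square independently with probability $p$ (and erase it with probability $1-p$), and let $M_1$ be the union of the kept sub-squares. Then each square in $M_1$ is divided into $n^2$ closed squares of side-length $1/n^2$, each kept independently (also of earlier choices) with probability $p$, and so on. After $k$ steps $M_k=M_k^{(p,n)}$ is the union of the kept level-$k$ squares of side-length $1/n^k$. The limit set is $M=M^{(p,n)}=\bigcap_{k=1}^\infty M_k$. $\dim_H$ denotes Hausdorff dimension, with the convention $\dim_H\emptyset=-1$. The topological Hausdorff dimension is defined by $\dim_{tH}\emptyset=-1$ and, for a non-empty metric space $X$, $\dim_{tH}X=\inf\{d: X \text{ has a basis } \mathcal U \text{ of open sets such that } \dim_H\partial U\le d-1 \text{ for every } U\in\mathcal U\}$ (where $d=\infty$ is allowed, with $\infty-1=\infty$). *)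

theory Defs
  imports "HOL-Probability.Probability"
begin

section \<open>Hausdorff measure and Hausdorff dimension\<close>

text \<open>The summand \<open>(diam U)\<^sup>s\<close> with the usual conventions \<open>(diam {})\<^sup>s = 0\<close> for all \<open>s\<close>
  and \<open>(diam U)\<^sup>0 = 1\<close> for \<open>U\<close> nonempty; the case split is needed because \<open>0 powr 0 = 0\<close>.\<close>

definition diam_power :: "real \<Rightarrow> 'a::metric_space set \<Rightarrow> ennreal" where
  "diam_power s U =
     (if U = {} then 0 else if s = 0 then 1 else ennreal (diameter U powr s))"

text \<open>Boundedness is required explicitly because \<^const>\<open>diameter\<close> is a meaningless real number
  on unbounded sets. Covers by arbitrary subsets of the ambient space give the same value as
  covers by subsets of \<open>A\<close>, so this is intrinsic to the metric space \<open>A\<close>.\<close>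

definition hausdorff_premeasure :: "real \<Rightarrow> real \<Rightarrow> 'a::metric_space set \<Rightarrow> ennreal" where
  "hausdorff_premeasure s \<delta> A =
     (INF U \<in> {U :: nat \<Rightarrow> 'a set. A \<subseteq> (\<Union>i. U i) \<and> (\<forall>i. bounded (U i) \<and> diameter (U i) \<le> \<delta>)}.
        (\<Sum>i. diam_power s (U i)))"

definition hausdorff_measure :: "real \<Rightarrow> 'a::metric_space set \<Rightarrow> ennreal" where
  "hausdorff_measure s A = (SUP \<delta> \<in> {0<..}. hausdorff_premeasure s \<delta> A)"

definition hausdorff_dim :: "'a::metric_space set \<Rightarrow> ereal" where
  "hausdorff_dim A =
     (if A = {} then -1 else Inf {ereal s | s. 0 \<le> s \<and> hausdorff_measure s A = 0})"


section \<open>Topological Hausdorff dimension\<close>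

text \<open>The metric space is a subset \<open>X\<close> of the ambient type with the induced metric; open sets and
  boundaries are taken relative to \<open>X\<close>. The equation
  \<open>openin (top_of_set X) = arbitrary union_of (\<lambda>U. U \<in> B)\<close> says that the relatively open sets are
  exactly the unions of members of \<open>B\<close>, i.e. that \<open>B\<close> is a basis of open sets of \<open>X\<close>.\<close>

definition top_hausdorff_dim :: "'a::metric_space set \<Rightarrow> ereal" where
  "top_hausdorff_dim X =
     (if X = {} then -1
      else Inf {d :: ereal. \<exists>B :: 'a set set.
             openin (top_of_set X) = arbitrary union_of (\<lambda>U. U \<in> B) \<and>
             (\<forall>U\<in>B. hausdorff_dim (top_of_set X frontier_of U) \<le> d - 1)})"


section \<open>Fractal percolation\<close>

text \<open>The triple \<open>(k, i, j)\<close> with \<open>i, j < n ^ k\<close> stands for the level-\<open>k\<close> square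
  \<open>[i/n\<^sup>k, (i+1)/n\<^sup>k] \<times> [j/n\<^sup>k, (j+1)/n\<^sup>k]\<close>. Its parent is
  \<open>(k - 1, i div n, j div n)\<close>.\<close>

definition grid_square :: "nat \<Rightarrow> nat \<times> nat \<times> nat \<Rightarrow> (real \<times> real) set" where
  "grid_square n = (\<lambda>(k, i, j).
     {real i / real n ^ k .. (real i + 1) / real n ^ k} \<times>
     {real j / real n ^ k .. (real j + 1) / real n ^ k})"

definition level_squares :: "nat \<Rightarrow> nat \<Rightarrow> (nat \<times> nat \<times> nat) set" where
  "level_squares n k = {k} \<times> {..<n ^ k} \<times> {..<n ^ k}"

text \<open>A choice function \<open>c\<close> records the outcome of the keep/erase decision for every square of
  level at least 1. A level-\<open>k\<close> square is present after \<open>k\<close> steps iff it and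
  all its ancestors were kept; decisions for squares whose parent is absent are ignored.\<close>

primrec kept_squares :: "nat \<Rightarrow> (nat \<times> nat \<times> nat \<Rightarrow> bool) \<Rightarrow> nat \<Rightarrow> (nat \<times> nat \<times> nat) set" where
  "kept_squares n c 0 = {(0, 0, 0)}"
| "kept_squares n c (Suc k) =
     {(l, i, j) \<in> level_squares n (Suc k).
        (k, i div n, j div n) \<in> kept_squares n c k \<and> c (l, i, j)}"

definition percolation_step :: "nat \<Rightarrow> (nat \<times> nat \<times> nat \<Rightarrow> bool) \<Rightarrow> nat \<Rightarrow> (real \<times> real) set" where
  "percolation_step n c k = (\<Union>q \<in> kept_squares n c k. grid_square n q)"

definition percolation_limit :: "nat \<Rightarrow> (nat \<times> nat \<times> nat \<Rightarrow> bool) \<Rightarrow> (real \<times> real) set" where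
  "percolation_limit n c = (\<Inter>k \<in> {1..}. percolation_step n c k)"

text \<open>\<open>keep q \<omega>\<close> is the decision for the square \<open>q\<close>: over all squares of level at least 1 these are
  independent events of probability \<open>p\<close>.\<close>

definition percolation_choices ::
    "'w measure \<Rightarrow> nat \<Rightarrow> real \<Rightarrow> (nat \<times> nat \<times> nat \<Rightarrow> 'w \<Rightarrow> bool) \<Rightarrow> bool" where
  "percolation_choices P n p keep \<longleftrightarrow>
     prob_space P \<and>
     prob_space.indep_vars P (\<lambda>_. count_space UNIV) keep (\<Union>k\<in>{1..}. level_squares n k) \<and>
     (\<forall>q \<in> (\<Union>k\<in>{1..}. level_squares n k). measure P {\<omega> \<in> space P. keep q \<omega>} = p)"

end

theory Submission
  imports Defs
begin

text \<open>For a set \<open>T\<close> of level-\<open>k\<close> squares, \<open>M\<close> is the union of two closed pieces, consisting of the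
  points that survive inside the squares of \<open>T\<close>, respectively of the complement \<open>- T\<close>. Removing
  the first piece leaves a relatively open set whose boundary lies in both pieces, and each point
  \<open>x \<in> M\<close> has arbitrarily small neighbourhoods of this form: take for \<open>T\<close> the squares not
  containing \<open>x\<close>.

  A point in both pieces lies at each level \<open>l \<ge> k\<close> in two touching kept squares with different
  level-\<open>k\<close> ancestors. There are \<open>O(n\<^sup>l)\<close> such pairs of squares, since they are located along the
  grid lines of level \<open>k\<close>, and each pair survives with probability at most \<open>p\<^bsup>2(l - k)\<^esup>\<close>, because
  below level \<open>k\<close> the two lines of ancestors are disjoint. Hence the expected \<open>t\<close>-dimensional size of
  the cover is \<open>O((n p\<^sup>2 n\<^bsup>-t\<^esup>)\<^sup>l)\<close>, which is summable for \<open>t > 1 + 2 log p / log n\<close>.\<close>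

section \<open>Ancestor lines and the geometry of grid squares\<close>

lemma kept_squares_level:
  assumes "(l', i, j) \<in> kept_squares n c l"
  shows "l' = l" "i < n ^ l" "j < n ^ l"
  using assms by (cases l; auto simp: level_squares_def)+

lemma kept_squares_ancestor:
  assumes "k \<le> l" "(l, i, j) \<in> kept_squares n c l"
  shows "(k, i div n ^ (l - k), j div n ^ (l - k)) \<in> kept_squares n c k"
  using assms
proof (induction l arbitrary: i j rule: dec_induct)
  case base
  then show ?case by simp
next
  case (step l)
  from step.prems have "(l, i div n, j div n) \<in> kept_squares n c l" by simp
  from step.IH[OF this] show ?case
    using step.hyps by (simp add: Suc_diff_le div_mult2_eq)
qed

text \<open>The square itself is included (\<open>m = l\<close>), level \<open>k\<close> is not:
  strictly below level \<open>k\<close> the choices for two squares with different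
  level-\<open>k\<close> ancestors never concern the same square.\<close>

definition ancestors :: "nat \<Rightarrow> nat \<Rightarrow> nat \<Rightarrow> nat \<times> nat \<Rightarrow> (nat \<times> nat \<times> nat) set" where
  "ancestors n k l = (\<lambda>(i, j). (\<lambda>m. (m, i div n ^ (l - m), j div n ^ (l - m))) ` {k<..l})"

lemma kept_squares_choices:
  assumes "(l, i, j) \<in> kept_squares n c l" "q \<in> ancestors n k l (i, j)"
  shows "c q"
proof -
  from assms(2) obtain m where m: "k < m" "m \<le> l" "q = (m, i div n ^ (l - m), j div n ^ (l - m))"
    by (auto simp: ancestors_def)
  then have "q \<in> kept_squares n c m"
    using kept_squares_ancestor[OF m(2) assms(1)] by simp
  with m show ?thesis by (cases m) auto
qed

lemma grid_square_ancestor: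
  assumes "0 < n" "k \<le> l"
  shows "grid_square n (l, i, j) \<subseteq> grid_square n (k, i div n ^ (l - k), j div n ^ (l - k))"
proof -
  define m where "m = n ^ (l - k)"
  have m: "0 < m" and nl: "real n ^ l = real n ^ k * real m"
    using assms by (simp_all add: m_def flip: power_add)
  have "real (i div m) / real n ^ k \<le> real i / real n ^ l \<and>
        (real i + 1) / real n ^ l \<le> (real (i div m) + 1) / real n ^ k" for i
  proof -
    have "real (i div m) * real m \<le> real i"
      by (metis div_times_less_eq_dividend of_nat_le_iff of_nat_mult)
    \<comment> \<open>Right endpoint: the strict bound \<open>i < (i div m + 1) * m\<close> between
      integers leaves room for a whole unit.\<close>
    moreover have "i + 1 \<le> (i div m + 1) * m"
      using m by (metis Suc_eq_plus1 Suc_leI dividend_less_div_times mult.commute mult_Suc_right add.commute)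
    then have "real (i + 1) \<le> real ((i div m + 1) * m)"
      by (simp only: of_nat_le_iff)
    then have "real i + 1 \<le> (real (i div m) + 1) * real m"
      by (simp add: algebra_simps)
    ultimately show ?thesis
      unfolding nl using m assms(1)
      by (simp add: pos_divide_le_eq pos_le_divide_eq mult.commute mult.left_commute)
  qed
  from this[of i] this[of j] show ?thesis
    unfolding m_def[symmetric] by (auto simp: grid_square_def)
qed

lemma grid_square_dist:
  assumes "x \<in> grid_square n (l, i, j)" "y \<in> grid_square n (l, i, j)"
  shows "dist x y \<le> 2 / real n ^ l"
proof -
  have "\<bar>fst x - fst y\<bar> \<le> 1 / real n ^ l" "\<bar>snd x - snd y\<bar> \<le> 1 / real n ^ l"
    using assms by (auto simp: grid_square_def add_divide_distrib abs_le_iff)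
  moreover have "dist x y \<le> dist (fst x) (fst y) + dist (snd x) (snd y)"
    unfolding dist_prod_def by (rule sqrt_sum_squares_le_sum) auto
  ultimately show ?thesis by (simp add: dist_real_def)
qed

lemma bounded_grid_square: "bounded (grid_square n q)"
  by (cases q) (simp add: grid_square_def bounded_Times)

lemma closed_grid_square: "closed (grid_square n q)"
  by (cases q) (simp add: grid_square_def closed_Times)

lemma diameter_grid_square: "diameter (grid_square n (l, i, j)) \<le> 2 / real n ^ l"
  by (rule diameter_le) (use grid_square_dist in \<open>auto simp: dist_norm\<close>)

section \<open>Splitting the limit set into two closed pieces\<close>

text \<open>Each level asks for some suitable square, with no nesting between levels. This makes the
  set an intersection over \<open>l\<close> of finite unions of closed squares, hence
  closed.\<close>

definition piece ::
    "nat \<Rightarrow> (nat \<times> nat \<times> nat \<Rightarrow> bool) \<Rightarrow> nat \<Rightarrow> (nat \<times> nat) set \<Rightarrow> (real \<times> real) set" where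
  "piece n c k T = {x. \<forall>l\<ge>k. \<exists>i j. (l, i, j) \<in> kept_squares n c l \<and>
     (i div n ^ (l - k), j div n ^ (l - k)) \<in> T \<and> x \<in> grid_square n (l, i, j)}"

lemma closed_piece: "closed (piece n c k T)"
proof -
  define S where "S l = {(i, j). (l, i, j) \<in> kept_squares n c l \<and>
    (i div n ^ (l - k), j div n ^ (l - k)) \<in> T}" for l
  have "finite (S l)" for l
    by (rule finite_subset[of _ "{..<n ^ l} \<times> {..<n ^ l}"])
      (auto simp: S_def dest: kept_squares_level)
  then have "closed (\<Union>z\<in>S l. grid_square n (l, z))" for l
    by (intro closed_UN) (simp_all add: closed_grid_square)
  moreover have "piece n c k T = (\<Inter>l\<in>{k..}. \<Union>z\<in>S l. grid_square n (l, z))"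
    by (auto simp: piece_def S_def)
  ultimately show ?thesis by auto
qed

text \<open>At every level a kept square around the point has its level-\<open>k\<close> ancestor in
  \<open>T\<close> or in \<open>- T\<close>. Having a witness of either kind is inherited by lower
  levels down to \<open>k\<close>, so one kind must occur at all levels.\<close>

lemma percolation_limit_subset_pieces:
  assumes "0 < n"
  shows "percolation_limit n c \<subseteq> piece n c k T \<union> piece n c k (- T)"
proof
  fix x assume x: "x \<in> percolation_limit n c"
  define Q where "Q S l \<longleftrightarrow> (\<exists>i j. (l, i, j) \<in> kept_squares n c l \<and>
     (i div n ^ (l - k), j div n ^ (l - k)) \<in> S \<and> x \<in> grid_square n (l, i, j))" for S l
  have down: "Q S l" if "Q S l'" "k \<le> l" "l \<le> l'" for S l l'
  proof -
    from that(1) obtain i j where ij: "(l', i, j) \<in> kept_squares n c l'"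
      "(i div n ^ (l' - k), j div n ^ (l' - k)) \<in> S" "x \<in> grid_square n (l', i, j)"
      by (auto simp: Q_def)
    have "n ^ (l' - k) = n ^ (l' - l) * n ^ (l - k)"
      using that by (simp flip: power_add)
    then show ?thesis
      unfolding Q_def
      using kept_squares_ancestor[OF that(3) ij(1)] ij(2)
        subsetD[OF grid_square_ancestor[OF assms that(3)] ij(3)]
      by (auto simp: div_mult2_eq)
  qed
  have "Q T l \<or> Q (- T) l" if "k \<le> l" for l
  proof -
    \<comment> \<open>Level \<open>Suc l\<close> is used because the limit set intersects only
      levels from 1 on, while \<open>l\<close> may be 0.\<close>
    have "x \<in> percolation_step n c (Suc l)"
      using x by (auto simp: percolation_limit_def)
    then obtain l' i j where "(l', i, j) \<in> kept_squares n c (Suc l)" "x \<in> grid_square n (l', i, j)"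
      unfolding percolation_step_def by auto
    then have "Q T (Suc l) \<or> Q (- T) (Suc l)"
      using kept_squares_level(1) unfolding Q_def by blast
    then show ?thesis using down that le_SucI by blast
  qed
  \<comment> \<open>If each alternative failed somewhere, both would fail at the larger of the two
    levels.\<close>
  then have "(\<forall>l\<ge>k. Q T l) \<or> (\<forall>l\<ge>k. Q (- T) l)"
    using down by (metis nle_le)
  then show "x \<in> piece n c k T \<union> piece n c k (- T)"
    by (simp add: piece_def Q_def)
qed

section \<open>Counting touching squares with different level-k ancestors\<close>

text \<open>The constraints on the coordinates say that the two squares touch, corners included.\<close>

definition separated_pairs :: "nat \<Rightarrow> nat \<Rightarrow> nat \<Rightarrow> ((nat \<times> nat) \<times> (nat \<times> nat)) set" where
  "separated_pairs n k l = {((i, j), (i', j')). i < n ^ l \<and> j < n ^ l \<and> i' < n ^ l \<and> j' < n ^ l \<and>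
     i \<le> i' + 1 \<and> i' \<le> i + 1 \<and> j \<le> j' + 1 \<and> j' \<le> j + 1 \<and>
     (i div n ^ (l - k), j div n ^ (l - k)) \<noteq> (i' div n ^ (l - k), j' div n ^ (l - k))}"

lemma finite_separated_pairs: "finite (separated_pairs n k l)"
  by (rule finite_subset[of _ "({..<n ^ l} \<times> {..<n ^ l}) \<times> ({..<n ^ l} \<times> {..<n ^ l})"])
    (auto simp: separated_pairs_def)

text \<open>Neighbours in different blocks of length \<open>m\<close> are consecutive, and the
  larger one starts a block, so it is a multiple \<open>m * a\<close>. The bit \<open>b\<close> is 0
  if this is \<open>i\<close> and 1 if it is \<open>i'\<close>.\<close>

lemma neighbours_div_neq:
  fixes i i' m :: nat
  assumes "i div m \<noteq> i' div m" "i \<le> i' + 1" "i' \<le> i + 1"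
  obtains a b where "b \<in> {0, 1}" "i = m * a - b" "i' = m * a - (1 - b)" "m * a \<in> {i, i'}"
proof -
  have step: "m * (Suc u div m) = Suc u" if "Suc u div m \<noteq> u div m" for u
    using that by (metis div_Suc dvd_eq_mod_eq_0 dvd_mult_div_cancel)
  consider "i = Suc i'" | "i' = Suc i" using assms by (metis le_antisym not_less_eq_eq Suc_eq_plus1 le_SucE)
  then show ?thesis
  proof cases
    case 1
    then show ?thesis using step[of i'] assms(1) by (intro that[of 0 "i div m"]) auto
  next
    case 2
    then show ?thesis using step[of i] assms(1) by (intro that[of 1 "i' div m"]) auto
  qed
qed

text \<open>A coordinate in which the level-\<open>k\<close> ancestors differ is next to one of
  \<open>n ^ k\<close> grid lines; the other coordinate has \<open>n ^ l\<close> values. The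
  constant is 12 = 2 * 2 * 3: two choices of the separating coordinate, two values of
  \<open>b\<close>, three of \<open>d\<close>.\<close>

lemma card_separated_pairs:
  assumes "0 < n" "k \<le> l"
  shows "card (separated_pairs n k l) \<le> 12 * n ^ k * n ^ l"
proof -
  define m where "m = n ^ (l - k)"
  have m: "0 < m" and nl: "n ^ l = m * n ^ k"
    using assms by (simp_all add: m_def flip: power_add)
  define D :: "(nat \<times> nat \<times> nat \<times> nat) set"
    where "D = {..<n ^ k} \<times> {..<n ^ l} \<times> {0, 1} \<times> {0, 1, 2}"
  \<comment> \<open>\<open>m * a\<close> is the larger first coordinate, \<open>b\<close> tells which of the two squares has it, and
    \<open>d - 1\<close> is the difference of the second coordinates; \<open>g\<close> swaps the roles of the coordinates.\<close>
  define f where "f = (\<lambda>(a, j, b, d). ((m * a - b, j), (m * a - (1 - b), j + d - (1::nat))))"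
  define g where "g = (\<lambda>((i, j), (i', j')). ((j, i), (j', i'))) \<circ> f"
  have fin: "finite D" and cD: "card D = 6 * n ^ k * n ^ l"
    by (simp_all add: D_def)
  have coord: "\<exists>a b d. a < n ^ k \<and> b \<in> {0, 1} \<and> d \<in> {0, 1, 2} \<and>
      i = m * a - b \<and> i' = m * a - (1 - b) \<and> j' = j + d - (1::nat)"
    if near: "i div m \<noteq> i' div m" "i \<le> i' + 1" "i' \<le> i + 1" "i < n ^ l" "i' < n ^ l"
      "j \<le> j' + 1" "j' \<le> j + 1" for i i' j j'
  proof -
    obtain a b where ab: "b \<in> {0, 1}" "i = m * a - b" "i' = m * a - (1 - b)" "m * a \<in> {i, i'}"
      using neighbours_div_neq[OF near(1-3)] by blast
    \<comment> \<open>As \<open>m * a\<close> is itself one of the two coordinates, it is below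
      \<open>n ^ l = m * n ^ k\<close>.\<close>
    have "m * a < m * n ^ k" using ab(4) near(4,5) nl by auto
    then have "a < n ^ k" by simp
    moreover have "j' + 1 - j \<in> {0, 1, 2}" "j' = j + (j' + 1 - j) - 1"
      using near(6,7) by auto
    ultimately show ?thesis using ab by blast
  qed
  have "separated_pairs n k l \<subseteq> f ` D \<union> g ` D"
  proof
    fix z assume "z \<in> separated_pairs n k l"
    then obtain i j i' j' where z: "z = ((i, j), (i', j'))" "i < n ^ l" "j < n ^ l" "i' < n ^ l" "j' < n ^ l"
       "i \<le> i' + 1" "i' \<le> i + 1" "j \<le> j' + 1" "j' \<le> j + 1"
       and "i div m \<noteq> i' div m \<or> j div m \<noteq> j' div m"
      by (auto simp: separated_pairs_def m_def)
    from this(10) show "z \<in> f ` D \<union> g ` D"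
    proof
      assume "i div m \<noteq> i' div m"
      from coord[OF this z(6,7,2,4,8,9)] obtain a b d where
        "(a, j, b, d) \<in> D" "z = f (a, j, b, d)"
        using z(1,3) by (auto simp: D_def f_def)
      then show ?thesis by blast
    next
      assume "j div m \<noteq> j' div m"
      from coord[OF this z(8,9,3,5,6,7)] obtain a b d where
        "(a, i, b, d) \<in> D" "z = g (a, i, b, d)"
        using z(1,2) by (auto simp: D_def f_def g_def)
      then show ?thesis by blast
    qed
  qed
  then have "card (separated_pairs n k l) \<le> card (f ` D \<union> g ` D)"
    by (intro card_mono) (auto simp: fin)
  also have "\<dots> \<le> card (f ` D) + card (g ` D)"
    by (rule card_Un_le)
  also have "\<dots> \<le> card D + card D"
    by (intro add_mono card_image_le fin)
  finally show ?thesis by (simp add: cD)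
qed

text \<open>Survival refers only to the choices below level \<open>k\<close>, which makes it a
  finite conjunction of independent events. It is weaker than both squares being kept, which is
  harmless for an upper bound.\<close>

definition surviving_pairs ::
    "nat \<Rightarrow> (nat \<times> nat \<times> nat \<Rightarrow> bool) \<Rightarrow> nat \<Rightarrow> nat \<Rightarrow> ((nat \<times> nat) \<times> (nat \<times> nat)) set" where
  "surviving_pairs n c k l = {z \<in> separated_pairs n k l.
     \<forall>q \<in> ancestors n k l (fst z) \<union> ancestors n k l (snd z). c q}"

text \<open>Two closed squares that share a point touch, and membership in \<open>T\<close> and
  \<open>- T\<close> tells their ancestors apart. The cover does not depend on \<open>T\<close>, so
  a single almost sure event for each \<open>k\<close> later serves all \<open>T\<close> at
  once.\<close>

lemma pieces_Int_subset:
  assumes "0 < n" "k \<le> l"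
  shows "piece n c k T \<inter> piece n c k (- T) \<subseteq>
    (\<Union>z\<in>surviving_pairs n c k l. grid_square n (l, fst z))"
proof
  fix x assume x: "x \<in> piece n c k T \<inter> piece n c k (- T)"
  from x assms obtain i j where 1: "(l, i, j) \<in> kept_squares n c l"
     "(i div n ^ (l - k), j div n ^ (l - k)) \<in> T" "x \<in> grid_square n (l, i, j)"
    by (auto simp: piece_def)
  from x assms obtain i' j' where 2: "(l, i', j') \<in> kept_squares n c l"
     "(i' div n ^ (l - k), j' div n ^ (l - k)) \<notin> T" "x \<in> grid_square n (l, i', j')"
    by (auto simp: piece_def)
  have near: "u \<le> Suc v" if "real u / real n ^ l \<le> y" "y \<le> (real v + 1) / real n ^ l" for u v y
  proof -
    have "real u / real n ^ l \<le> (real v + 1) / real n ^ l" using that by linarith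
    then have "real u \<le> real v + 1" using assms(1) by (simp add: divide_le_cancel)
    then show ?thesis by linarith
  qed
  have "i \<le> i' + 1" "i' \<le> i + 1" "j \<le> j' + 1" "j' \<le> j + 1"
    using 1(3) 2(3) by (auto simp: grid_square_def intro!: near)
  then have "((i, j), (i', j')) \<in> separated_pairs n k l"
    using 1(2) 2(2) kept_squares_level[OF 1(1)] kept_squares_level[OF 2(1)]
    by (auto simp: separated_pairs_def)
  then have "((i, j), (i', j')) \<in> surviving_pairs n c k l"
    using kept_squares_choices[OF 1(1)] kept_squares_choices[OF 2(1)]
    by (auto simp: surviving_pairs_def)
  with 1(3) show "x \<in> (\<Union>z\<in>surviving_pairs n c k l. grid_square n (l, fst z))"
    by force
qed

section \<open>Expected number of surviving pairs\<close>

lemma ancestors_subset: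
  assumes "0 < n" "i < n ^ l" "j < n ^ l"
  shows "ancestors n k l (i, j) \<subseteq> (\<Union>k\<in>{1..}. level_squares n k)"
proof -
  have "i div n ^ (l - m) < n ^ m" if "m \<le> l" "i < n ^ l" for i m
  proof -
    have "n ^ l = n ^ m * n ^ (l - m)" using that by (simp flip: power_add)
    then show ?thesis using that by (simp add: less_mult_imp_div_less)
  qed
  with assms show ?thesis by (auto simp: ancestors_def level_squares_def)
qed

lemma finite_ancestors: "finite (ancestors n k l z)"
  by (cases z) (simp add: ancestors_def)

lemma card_ancestors: "card (ancestors n k l z) = l - k"
  by (cases z) (simp add: ancestors_def card_image inj_on_def)

text \<open>A common ancestor at a level \<open>m > k\<close> would force a common ancestor at level
  \<open>k\<close>.\<close>

lemma ancestors_disjoint: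
  assumes "(z, z') \<in> separated_pairs n k l"
  shows "ancestors n k l z \<inter> ancestors n k l z' = {}"
proof (rule ccontr)
  assume "\<not> ?thesis"
  moreover obtain i j i' j' where z: "z = (i, j)" "z' = (i', j')" by fastforce
  ultimately obtain m where m: "k < m" "m \<le> l" "i div n ^ (l - m) = i' div n ^ (l - m)"
    "j div n ^ (l - m) = j' div n ^ (l - m)"
    by (auto simp: ancestors_def)
  have "n ^ (l - k) = n ^ (l - m) * n ^ (m - k)" using m(1,2) by (simp flip: power_add)
  then have "i div n ^ (l - k) = i' div n ^ (l - k)" "j div n ^ (l - k) = j' div n ^ (l - k)"
    using m(3,4) by (simp_all add: div_mult2_eq)
  with assms show False by (auto simp: separated_pairs_def z)
qed

lemma percolation_choices_all_kept:
  assumes "percolation_choices P n p keep" "finite J" "J \<subseteq> (\<Union>k\<in>{1..}. level_squares n k)"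
  shows "{\<omega> \<in> space P. \<forall>q\<in>J. keep q \<omega>} \<in> sets P"
    and "measure P {\<omega> \<in> space P. \<forall>q\<in>J. keep q \<omega>} = p ^ card J"
proof -
  interpret prob_space P using assms(1) by (simp add: percolation_choices_def)
  have indep: "indep_vars (\<lambda>_. count_space UNIV) keep (\<Union>k\<in>{1..}. level_squares n k)"
    and prob: "\<And>q. q \<in> J \<Longrightarrow> prob {\<omega> \<in> space P. keep q \<omega>} = p"
    using assms by (auto simp: percolation_choices_def)
  have "keep q \<in> measurable P (count_space UNIV)" if "q \<in> J" for q
    using indep that assms(3) by (auto simp: indep_vars_def)
  then have [measurable]: "Measurable.pred P (keep q)" if "q \<in> J" for q using that by simp
  show "{\<omega> \<in> space P. \<forall>q\<in>J. keep q \<omega>} \<in> sets P"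
    using assms(2) by (intro sets.sets_Collect_finite_All) (auto intro: predE)
  show "prob {\<omega> \<in> space P. \<forall>q\<in>J. keep q \<omega>} = p ^ card J"
  \<comment> \<open>The product rule for independent variables asks for a nonempty index set; the
    empty one arises for \<open>l = k\<close>.\<close>
  proof (cases "J = {}")
    case True
    then show ?thesis by (simp add: prob_space)
  next
    case False
    have eq: "keep q -` {True} \<inter> space P = {\<omega> \<in> space P. keep q \<omega>}" for q by auto
    have "{\<omega> \<in> space P. \<forall>q\<in>J. keep q \<omega>} = (\<Inter>q\<in>J. keep q -` {True} \<inter> space P)"
      using False by auto
    also have "prob \<dots> = (\<Prod>q\<in>J. prob (keep q -` {True} \<inter> space P))"
      by (rule indep_varsD[OF indep False assms(2,3)]) simp
    also have "\<dots> = p ^ card J"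
      by (simp add: eq prob)
    finally show ?thesis .
  qed
qed

text \<open>Linearity of expectation: the two disjoint lines of ancestors contain
  \<open>2 * (l - k)\<close> squares, so each separated pair survives with probability
  \<open>p ^ (2 * (l - k))\<close>, and the pairs have been counted.\<close>

lemma nn_integral_card_surviving_pairs:
  assumes "percolation_choices P n p keep" "0 < n" "k \<le> l" "0 \<le> p"
  shows "(\<lambda>\<omega>. of_nat (card (surviving_pairs n (\<lambda>q. keep q \<omega>) k l)) :: ennreal) \<in> borel_measurable P"
    and "(\<integral>\<^sup>+\<omega>. of_nat (card (surviving_pairs n (\<lambda>q. keep q \<omega>) k l)) \<partial>P)
      \<le> ennreal (12 * real n ^ k * real n ^ l * p ^ (2 * (l - k)))"
proof -
  interpret prob_space P using assms(1) by (simp add: percolation_choices_def)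
  define J where "J z = ancestors n k l (fst z) \<union> ancestors n k l (snd z)" for z
  define K where "K z = {\<omega> \<in> space P. \<forall>q\<in>J z. keep q \<omega>}" for z
  have fin: "finite (J z)" for z by (simp add: J_def finite_ancestors)
  have sub: "J z \<subseteq> (\<Union>k\<in>{1..}. level_squares n k)" if "z \<in> separated_pairs n k l" for z
    using that ancestors_subset[OF assms(2)] by (fastforce simp: J_def separated_pairs_def)
  have card: "card (J z) = 2 * (l - k)" if "z \<in> separated_pairs n k l" for z
    unfolding J_def using that ancestors_disjoint[of "fst z" "snd z" n k l]
    by (subst card_Un_disjoint) (auto simp: finite_ancestors card_ancestors)
  have K: "K z \<in> sets P" "measure P (K z) = p ^ (2 * (l - k))"
    if "z \<in> separated_pairs n k l" for z
    using percolation_choices_all_kept[OF assms(1) fin sub[OF that]] card[OF that]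
    by (simp_all add: K_def)
  have eq: "of_nat (card (surviving_pairs n (\<lambda>q. keep q \<omega>) k l)) =
      (\<Sum>z\<in>separated_pairs n k l. indicator (K z) \<omega> :: ennreal)" if "\<omega> \<in> space P" for \<omega>
  proof -
    have "(\<Sum>z\<in>separated_pairs n k l. indicator (K z) \<omega> :: ennreal) =
      (\<Sum>z\<in>separated_pairs n k l. if z \<in> surviving_pairs n (\<lambda>q. keep q \<omega>) k l then 1 else 0)"
      using that by (intro sum.cong) (auto simp: K_def surviving_pairs_def J_def)
    also have "\<dots> = of_nat (card (surviving_pairs n (\<lambda>q. keep q \<omega>) k l))"
      by (subst sum.inter_restrict[symmetric])
        (auto simp: finite_separated_pairs surviving_pairs_def Int_def intro!: arg_cong[where f=card])
    finally show ?thesis by simp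
  qed
  show "(\<lambda>\<omega>. of_nat (card (surviving_pairs n (\<lambda>q. keep q \<omega>) k l)) :: ennreal) \<in> borel_measurable P"
    by (subst measurable_cong[OF eq]) (auto intro!: borel_measurable_sum borel_measurable_indicator K)
  have "(\<integral>\<^sup>+\<omega>. of_nat (card (surviving_pairs n (\<lambda>q. keep q \<omega>) k l)) \<partial>P)
      = (\<integral>\<^sup>+\<omega>. (\<Sum>z\<in>separated_pairs n k l. indicator (K z) \<omega>) \<partial>P)"
    by (rule nn_integral_cong) (rule eq)
  also have "\<dots> = (\<Sum>z\<in>separated_pairs n k l. emeasure P (K z))"
    by (subst nn_integral_sum) (auto intro!: borel_measurable_indicator sum.cong nn_integral_indicator K)
  also have "\<dots> = (\<Sum>z\<in>separated_pairs n k l. ennreal (p ^ (2 * (l - k))))"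
    by (intro sum.cong) (auto simp: emeasure_eq_measure K)
  also have "\<dots> = ennreal (real (card (separated_pairs n k l)) * p ^ (2 * (l - k)))"
    using assms(4) by (simp add: ennreal_mult ennreal_of_nat_eq_real_of_nat)
  also have "\<dots> \<le> ennreal (12 * real n ^ k * real n ^ l * p ^ (2 * (l - k)))"
  proof (intro ennreal_leI mult_right_mono)
    show "real (card (separated_pairs n k l)) \<le> 12 * real n ^ k * real n ^ l"
      using of_nat_mono[OF card_separated_pairs[OF assms(2,3)], where 'a=real] by simp
  qed (use assms(4) in simp)
  finally show "(\<integral>\<^sup>+\<omega>. of_nat (card (surviving_pairs n (\<lambda>q. keep q \<omega>) k l)) \<partial>P)
      \<le> ennreal (12 * real n ^ k * real n ^ l * p ^ (2 * (l - k)))" .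
qed

section \<open>Hausdorff measure of the intersection of the pieces\<close>

lemma hausdorff_premeasure_le_card:
  assumes "finite F" "A \<subseteq> (\<Union>z\<in>F. G z)" "\<And>z. z \<in> F \<Longrightarrow> bounded (G z)"
    "\<And>z. z \<in> F \<Longrightarrow> diameter (G z) \<le> r" "0 \<le> r" "r \<le> \<delta>" "0 < s"
  shows "hausdorff_premeasure s \<delta> A \<le> of_nat (card F) * ennreal (r powr s)"
proof -
  obtain h where h: "bij_betw h {0..<card F} F"
    using ex_bij_betw_nat_finite[OF assms(1)] by blast
  \<comment> \<open>Covers are sequences, so the finite family is padded with empty sets, which
    contribute 0 to the sum.\<close>
  define U where "U i = (if i < card F then G (h i) else {})" for i
  have hF: "h i \<in> F" if "i < card F" for i using h that by (auto simp: bij_betw_def)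
  have "(\<Union>z\<in>F. G z) \<subseteq> (\<Union>i. U i)"
  proof
    fix x assume "x \<in> (\<Union>z\<in>F. G z)"
    then obtain z where z: "z \<in> F" "x \<in> G z" by blast
    with h obtain i where "i < card F" "z = h i"
      by (metis atLeastLessThan_iff bij_betw_imp_surj_on imageE)
    with z have "i < card F" "x \<in> G (h i)" by auto
    then have "x \<in> U i" by (simp add: U_def)
    then show "x \<in> (\<Union>i. U i)" by blast
  qed
  with assms(2) have "A \<subseteq> (\<Union>i. U i)" by (rule order_trans)
  moreover have "bounded (U i) \<and> diameter (U i) \<le> \<delta>" for i
    using assms(3)[of "h i"] assms(4)[of "h i"] assms(5,6) hF[of i] by (auto simp: U_def)
  ultimately have "hausdorff_premeasure s \<delta> A \<le> (\<Sum>i. diam_power s (U i))"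
    unfolding hausdorff_premeasure_def by (intro INF_lower CollectI conjI allI) simp_all
  also have "\<dots> = (\<Sum>i<card F. diam_power s (U i))"
    by (rule suminf_finite) (auto simp: U_def diam_power_def)
  also have "\<dots> \<le> (\<Sum>i<card F. ennreal (r powr s))"
  proof (rule sum_mono)
    fix i assume "i \<in> {..<card F}"
    then have "0 \<le> diameter (U i)" "diameter (U i) \<le> r"
      using assms(3,4) hF[of i] by (auto simp: U_def intro: diameter_ge_0)
    then show "diam_power s (U i) \<le> ennreal (r powr s)"
      using assms(7) by (auto simp: diam_power_def intro!: ennreal_leI powr_mono2)
  qed
  finally show ?thesis by simp
qed

text \<open>Once \<open>2 / real n ^ (k + m) < \<delta>\<close>, the level-\<open>(k + m)\<close>
  cover is admissible at scale \<open>\<delta>\<close>, and its cost is at most the term that tends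
  to 0.\<close>

lemma hausdorff_measure_pieces_Int:
  assumes "2 \<le> n" "0 < t"
    and lim: "(\<lambda>m. of_nat (card (surviving_pairs n c k (k + m))) * ennreal ((2 / real n ^ (k + m)) powr t)) \<longlonglongrightarrow> 0"
  shows "hausdorff_measure t (piece n c k T \<inter> piece n c k (- T)) = 0"
proof -
  have small: "(\<lambda>m. 2 / real n ^ (k + m)) \<longlonglongrightarrow> 0"
  proof -
    have "(\<lambda>m. (2 / real n ^ k) * (1 / real n) ^ m) \<longlonglongrightarrow> (2 / real n ^ k) * 0"
      using assms(1) by (intro tendsto_mult tendsto_const LIMSEQ_realpow_zero) auto
    then show ?thesis by (simp add: power_add power_divide field_simps)
  qed
  have "hausdorff_premeasure t \<delta> (piece n c k T \<inter> piece n c k (- T)) \<le> 0" if "0 < \<delta>" for \<delta>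
  proof (rule tendsto_lowerbound[OF lim])
    have "\<forall>\<^sub>F m in sequentially. 2 / real n ^ (k + m) < \<delta>"
      using order_tendstoD(2)[OF small that] .
    then show "\<forall>\<^sub>F m in sequentially. hausdorff_premeasure t \<delta> (piece n c k T \<inter> piece n c k (- T))
        \<le> of_nat (card (surviving_pairs n c k (k + m))) * ennreal ((2 / real n ^ (k + m)) powr t)"
    proof eventually_elim
      case (elim m)
      show ?case
      proof (rule hausdorff_premeasure_le_card)
        show "piece n c k T \<inter> piece n c k (- T) \<subseteq>
            (\<Union>z\<in>surviving_pairs n c k (k + m). grid_square n (k + m, fst z))"
          using assms(1) by (intro pieces_Int_subset) auto
        show "finite (surviving_pairs n c k (k + m))"
          using finite_separated_pairs by (simp add: surviving_pairs_def)
        show "diameter (grid_square n (k + m, fst z)) \<le> 2 / real n ^ (k + m)" for z :: "(nat \<times> nat) \<times> (nat \<times> nat)"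
          using diameter_grid_square by (metis surj_pair)
      qed (use elim assms in \<open>auto simp: bounded_grid_square\<close>)
    qed
  qed simp
  then show ?thesis
    by (simp add: hausdorff_measure_def SUP_eq_iff)
qed

lemma hausdorff_measure_mono: "A \<subseteq> B \<Longrightarrow> hausdorff_measure s A \<le> hausdorff_measure s B"
  unfolding hausdorff_measure_def hausdorff_premeasure_def
  by (intro SUP_mono' INF_superset_mono) auto

text \<open>Testing only exponents \<open>s + 1 / real (Suc m)\<close> keeps the number of almost
  sure events countable.\<close>

lemma hausdorff_dim_le:
  assumes "0 \<le> s" "\<And>m. hausdorff_measure (s + 1 / real (Suc m)) A = 0"
  shows "hausdorff_dim A \<le> ereal s"
proof (cases "A = {}")
  case True
  with assms(1) show ?thesis by (simp add: hausdorff_dim_def one_ereal_def)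
next
  case False
  have le: "hausdorff_dim A \<le> ereal (s + 1 / real (Suc m))" for m
    unfolding hausdorff_dim_def using False assms(1) assms(2)[of m]
    by (auto intro!: Inf_lower)
  have lim: "(\<lambda>m. ereal (s + 1 / real (Suc m))) \<longlonglongrightarrow> ereal (s + 0)"
    by (intro tendsto_ereal tendsto_add tendsto_const LIMSEQ_Suc[OF lim_1_over_n])
  have "hausdorff_dim A \<le> ereal (s + 0)"
    by (rule tendsto_lowerbound[OF lim always_eventually trivial_limit_sequentially]) (rule allI le)+
  then show ?thesis by simp
qed

section \<open>A basis with small boundaries\<close>

lemma top_hausdorff_dim_percolation_limit_le:
  assumes "2 \<le> n" "0 \<le> s"
    and null: "\<And>k m T. hausdorff_measure (s + 1 / real (Suc m)) (piece n c k T \<inter> piece n c k (- T)) = 0"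
  shows "top_hausdorff_dim (percolation_limit n c) \<le> ereal (s + 1)"
proof (cases "percolation_limit n c = {}")
  case True
  with assms(2) show ?thesis by (simp add: top_hausdorff_dim_def one_ereal_def)
next
  case False
  define M where "M = percolation_limit n c"
  \<comment> \<open>All relatively open sets with small boundary are taken, so only the existence of
    small neighbourhoods in \<open>B\<close> has to be shown.\<close>
  define B where "B = {U. openin (top_of_set M) U \<and> hausdorff_dim (top_of_set M frontier_of U) \<le> ereal s}"
  have "\<exists>V. V \<in> B \<and> x \<in> V \<and> V \<subseteq> W" if W: "openin (top_of_set M) W" "x \<in> W" for W x
  proof -
    from W obtain e where x: "x \<in> M" and e: "0 < e" "\<And>y. y \<in> M \<Longrightarrow> dist y x < e \<Longrightarrow> y \<in> W"
      unfolding openin_euclidean_subtopology_iff by (metis subsetD)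
    \<comment> \<open>The bound \<open>e / 2\<close> matches the estimate
      \<open>2 / real n ^ k\<close> for distances within a square.\<close>
    obtain k where k: "(1 / real n) ^ k < e / 2"
      using real_arch_pow_inv[of "e / 2" "1 / real n"] e(1) assms(1) by auto
    define T where "T = {(a, b). x \<notin> grid_square n (k, a, b)}"
    define K where "K = piece n c k T"
    define V where "V = M - K"
    have M: "M \<subseteq> K \<union> piece n c k (- T)"
      unfolding M_def K_def using assms(1) by (intro percolation_limit_subset_pieces) simp
    have K: "closed K" by (simp add: K_def closed_piece)
    have V: "openin (top_of_set M) V"
      unfolding V_def Diff_eq using K by (intro openin_open_Int open_Compl)
    have "top_of_set M frontier_of V \<subseteq> K \<inter> piece n c k (- T)"
    proof -
      have "top_of_set M closure_of V \<subseteq> M \<inter> piece n c k (- T)"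
        by (intro closure_of_minimal closedin_closed_Int closed_piece) (use M in \<open>auto simp: V_def\<close>)
      moreover have "top_of_set M closure_of (M - V) \<subseteq> M \<inter> K"
        by (intro closure_of_minimal closedin_closed_Int K) (auto simp: V_def)
      ultimately show ?thesis by (auto simp: frontier_of_closures)
    qed
    then have "hausdorff_measure (s + 1 / real (Suc m)) (top_of_set M frontier_of V) = 0" for m
      using hausdorff_measure_mono null[of m k T] unfolding K_def by (metis le_zero_eq)
    then have "V \<in> B"
      using V assms(2) by (simp add: B_def hausdorff_dim_le)
    \<comment> \<open>At level \<open>l = k\<close>, membership in \<open>K\<close> would give a
      square of \<open>T\<close> containing \<open>x\<close>.\<close>
    moreover have "x \<in> V"
      using x by (auto simp: V_def K_def piece_def T_def)
    moreover have "V \<subseteq> W"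
    proof
      fix y assume y: "y \<in> V"
      \<comment> \<open>At level \<open>k\<close> the other piece provides a square outside
        \<open>T\<close> containing \<open>y\<close>; being outside \<open>T\<close>, it contains
        \<open>x\<close> too.\<close>
      then have "y \<in> piece n c k (- T)" using M by (auto simp: V_def)
      then obtain i j where "y \<in> grid_square n (k, i, j)" "x \<in> grid_square n (k, i, j)"
        by (force simp: piece_def T_def)
      then have "dist y x \<le> 2 / real n ^ k" by (rule grid_square_dist)
      also have "\<dots> < e" using k by (simp add: power_divide)
      finally show "y \<in> W" using e(2) y by (simp add: V_def)
    qed
    ultimately show ?thesis by blast
  qed
  then have "openin (top_of_set M) = arbitrary union_of (\<lambda>U. U \<in> B)"
    by (subst openin_topology_base_unique) (auto simp: B_def)
  moreover have "\<forall>U\<in>B. hausdorff_dim (top_of_set M frontier_of U) \<le> ereal (s + 1) - 1"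
    by (simp add: B_def one_ereal_def)
  ultimately show ?thesis
    using False unfolding top_hausdorff_dim_def M_def by (auto intro!: Inf_lower)
qed

section \<open>Almost sure convergence and conclusion\<close>

text \<open>The expected costs decay geometrically, so their sum has finite expectation and is
  almost surely finite; hence the terms tend to 0.\<close>

lemma AE_surviving_pairs_tendsto:
  assumes "2 \<le> n" "0 < p" "percolation_choices P n p keep"
    and t: "1 + 2 * (ln p / ln (real n)) < t"
  shows "AE \<omega> in P. (\<lambda>m. of_nat (card (surviving_pairs n (\<lambda>q. keep q \<omega>) k (k + m))) *
    ennreal ((2 / real n ^ (k + m)) powr t)) \<longlonglongrightarrow> 0"
proof -
  define f where "f m \<omega> = of_nat (card (surviving_pairs n (\<lambda>q. keep q \<omega>) k (k + m))) *
    ennreal ((2 / real n ^ (k + m)) powr t)" for m \<omega>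
  have n: "0 < n" "1 < real n" using assms(1) by auto
  \<comment> \<open>\<open>C\<close> collects the factors belonging to level \<open>k\<close>. Each
    further level multiplies the number of pairs by \<open>n\<close>, their probability by
    \<open>p ^ 2\<close> and the cost of a square by \<open>real n powr (- t)\<close>; this is
    \<open>\<rho>\<close>.\<close>
  define C where "C = 12 * real n ^ k * real n ^ k * (2 / real n ^ k) powr t"
  define \<rho> where "\<rho> = real n * p ^ 2 * real n powr (- t)"
  have meas[measurable]: "f m \<in> borel_measurable P" for m
    unfolding f_def using nn_integral_card_surviving_pairs(1)[OF assms(3) n(1), of k "k + m"] assms(2)
    by (intro borel_measurable_times_ennreal) auto
  have "0 < \<rho>" using n assms(2) by (simp add: \<rho>_def)
  \<comment> \<open>The condition on \<open>t\<close> says exactly that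
    \<open>\<rho> < 1\<close>.\<close>
  have "ln \<rho> = ln (real n) + 2 * ln p - t * ln (real n)"
    using n assms(2) by (simp add: \<rho>_def ln_mult ln_powr ln_realpow)
  also have "\<dots> = (1 + 2 * (ln p / ln (real n)) - t) * ln (real n)"
    using n by (simp add: field_simps)
  also have "\<dots> < 0" using t n by (intro mult_neg_pos) auto
  finally have "\<rho> < 1" using \<open>0 < \<rho>\<close> by simp
  have int: "(\<integral>\<^sup>+\<omega>. f m \<omega> \<partial>P) \<le> ennreal (C * \<rho> ^ m)" for m
  proof -
    have "(\<integral>\<^sup>+\<omega>. f m \<omega> \<partial>P) = (\<integral>\<^sup>+\<omega>. of_nat (card (surviving_pairs n (\<lambda>q. keep q \<omega>) k (k + m))) \<partial>P) *
        ennreal ((2 / real n ^ (k + m)) powr t)"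
      unfolding f_def using assms(2)
      by (intro nn_integral_multc nn_integral_card_surviving_pairs(1)[OF assms(3) n(1)]) auto
    also have "\<dots> \<le> ennreal (12 * real n ^ k * real n ^ (k + m) * p ^ (2 * (k + m - k))) *
        ennreal ((2 / real n ^ (k + m)) powr t)"
      using assms(2) by (intro mult_right_mono nn_integral_card_surviving_pairs(2)[OF assms(3) n(1)]) auto
    also have "\<dots> = ennreal (12 * real n ^ k * real n ^ (k + m) * p ^ (2 * m) * (2 / real n ^ (k + m)) powr t)"
      using assms(2) by (simp add: ennreal_mult)
    also have "12 * real n ^ k * real n ^ (k + m) * p ^ (2 * m) * (2 / real n ^ (k + m)) powr t = C * \<rho> ^ m"
    proof -
      have "(2 / real n ^ (k + m)) powr t = ((2 / real n ^ k) * (1 / real n ^ m)) powr t"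
        by (simp add: power_add)
      also have "\<dots> = (2 / real n ^ k) powr t * (1 / real n ^ m) powr t"
        by (rule powr_mult)
      also have "(1 / real n ^ m) powr t = (real n powr (- t)) ^ m"
      proof -
        have "1 / real n ^ m = real n powr (- real m)"
          using n by (simp add: powr_minus_divide powr_realpow)
        moreover have "(real n powr (- t)) ^ m = (real n powr (- t)) powr real m"
          using n by (simp add: powr_realpow)
        ultimately show ?thesis by (simp add: powr_powr mult.commute)
      qed
      finally show ?thesis
        unfolding C_def \<rho>_def power_mult[of p 2 m]
        by (simp add: power_mult_distrib power_add mult_ac)
    qed
    finally show ?thesis .
  qed
  have "(\<integral>\<^sup>+\<omega>. (\<Sum>m. f m \<omega>) \<partial>P) = (\<Sum>m. \<integral>\<^sup>+\<omega>. f m \<omega> \<partial>P)"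
    by (rule nn_integral_suminf) simp
  also have "\<dots> \<le> (\<Sum>m. ennreal (C * \<rho> ^ m))"
    by (intro suminf_le int) auto
  also have "\<dots> = ennreal (\<Sum>m. C * \<rho> ^ m)"
    using \<open>0 < \<rho>\<close> \<open>\<rho> < 1\<close> by (intro suminf_ennreal2 summable_mult summable_geometric) (auto simp: C_def)
  finally have "(\<integral>\<^sup>+\<omega>. (\<Sum>m. f m \<omega>) \<partial>P) \<noteq> \<infinity>"
    by (auto simp: top_unique)
  then have "AE \<omega> in P. (\<Sum>m. f m \<omega>) \<noteq> \<infinity>"
    by (intro nn_integral_PInf_AE) auto
  then show ?thesis
  proof eventually_elim
    case (elim \<omega>)
    then have "(\<Sum>m. f m \<omega>) < top" by (simp add: less_top)
    then have "f m \<omega> < top" for m by (rule ennreal_suminf_lessD)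
    \<comment> \<open>Finite terms can be read as reals, where summability yields a null
      sequence.\<close>
    then have eq: "ennreal (enn2real (f m \<omega>)) = f m \<omega>" for m by simp
    have "summable (\<lambda>m. enn2real (f m \<omega>))"
      by (rule summable_suminf_not_top) (use elim in \<open>simp_all add: eq\<close>)
    then have "(\<lambda>m. ennreal (enn2real (f m \<omega>))) \<longlonglongrightarrow> ennreal 0"
      by (intro tendsto_ennrealI summable_LIMSEQ_zero)
    then show ?case unfolding eq by (simp add: f_def)
  qed
qed

theorem theorem6p17:
  fixes n :: nat and p :: real
    and P :: "'w measure" and keep :: "nat \<times> nat \<times> nat \<Rightarrow> 'w \<Rightarrow> bool"
  assumes "n \<ge> 2" and "0 < p" and "p < 1"
    and "percolation_choices P n p keep"
    and "p > 1 / sqrt (real n)"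
  shows "AE \<omega> in P.
           top_hausdorff_dim (percolation_limit n (\<lambda>q. keep q \<omega>))
             \<le> ereal (2 + 2 * (ln p / ln (real n)))"
proof -
  define s where "s = 1 + 2 * (ln p / ln (real n))"
  have n: "1 < real n" using assms(1) by simp
  \<comment> \<open>The bound \<open>p > 1 / sqrt (real n)\<close> makes \<open>s\<close> positive;
    \<open>s\<close> bounds the dimension of boundaries, for which only nonnegative exponents are
    considered.\<close>
  have "ln (1 / sqrt (real n)) < ln p" using assms(2,5) n by (subst ln_less_cancel_iff) auto
  then have "- ln (real n) < 2 * ln p" using n by (simp add: ln_div ln_sqrt)
  then have s: "0 < s" using n by (simp add: s_def field_simps)
  \<comment> \<open>Only countably many pairs \<open>k\<close>, \<open>m\<close> occur, so the
    exceptional null sets can be united.\<close>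
  have "AE \<omega> in P. \<forall>k m. (\<lambda>l. of_nat (card (surviving_pairs n (\<lambda>q. keep q \<omega>) k (k + l))) *
    ennreal ((2 / real n ^ (k + l)) powr (s + 1 / real (Suc m)))) \<longlonglongrightarrow> 0"
    unfolding AE_all_countable
    by (intro allI AE_surviving_pairs_tendsto[OF assms(1,2,4)]) (simp add: s_def)
  then show ?thesis
  proof eventually_elim
    case (elim \<omega>)
    have "top_hausdorff_dim (percolation_limit n (\<lambda>q. keep q \<omega>)) \<le> ereal (s + 1)"
      by (intro top_hausdorff_dim_percolation_limit_le hausdorff_measure_pieces_Int)
        (use assms(1) s elim in \<open>auto simp: add_pos_pos\<close>)
    then show ?case by (simp add: s_def)
  qed
qed

end
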